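(* Let $n,m$ be positive integers and $0<\varepsilon<1/4$. Let $G$ be an abelian group, $Y\subseteq G$ with $|Y|=n$, and $\beta=\beta_G((1+4\varepsilon)m)$. There exists a collection $\mathcal{C}\subseteq 2^{Y+Y}\times2^Y\times2^Y$ with $|\mathcal{C}|\le n^{2^7\varepsilon^{-2}\sqrt m}$ such that the following holds. For every pair $(A,B)$ of subsets of $Y$ with $|A|\ge\sqrt m$, $|B|\ge(1+\varepsilon^{-2})\sqrt m$ and $|A+B|\le m$, there exists $(C_0,C_1,C_2)\in\mathcal{C}$ such that (1) $(Y+Y)\setminus(A+B)\subseteq C_0$, $A\subseteq C_1$ and $B\subseteq C_2$; (2) $|C_1|+|C_2|\le(1+2\varepsilon)(m+\beta)$. Additionally, every $(C_0,C_1,C_2)\in\mathcal{C}$ satisfies $|C_1|,|C_2|\le m/4$ or $e(\mathcal{H}(C_0,C_1,C_2))<\varepsilon^2|C_1||C_2|$.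
   Context: For an abelian group $G$ and real $x>0$, $\beta_G(x)$ denotes the largest size of a subgroup $H\le G$ with $|H|\le x$. For $U_0\subseteq Y+Y$ and $U_1,U_2\subseteq Y$, $\mathcal{H}(U_0,U_1,U_2)$ is the tripartite $3$-uniform hypergraph with parts $U_0,U_1,U_2$ (treated as disjoint copies) in which $a\in U_1$, $b\in U_2$, $c\in U_0$ form an edge iff $c=a+b$; $e(\cdot)$ is its number of edges. Logarithms are base $2$. *)

theory Defs
  imports Complex_Main "HOL-Library.Set_Algebras"
begin

definition add_subgroup :: "'a::ab_group_add set \<Rightarrow> bool" where
  "add_subgroup H \<longleftrightarrow> 0 \<in> H \<and> (\<forall>x\<in>H. \<forall>y\<in>H. x + y \<in> H) \<and> (\<forall>x\<in>H. - x \<in> H)"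

text \<open>
  The ambient group \<open>G\<close> is the type \<^typ>\<open>'a\<close>. Only finite subgroups compete
  (\<^const>\<open>card\<close> of an infinite set is \<open>0\<close>, hence the explicit \<^const>\<open>finite\<close>). The
  maximum is over a finite set of naturals, which is nonempty for \<open>x \<ge> 1\<close> because of the
  trivial subgroup; for \<open>x < 1\<close> there is no such subgroup and the value is irrelevant.
\<close>

definition beta :: "'a::ab_group_add itself \<Rightarrow> real \<Rightarrow> nat" where
  "beta G x = Max {card H | H :: 'a set. add_subgroup H \<and> finite H \<and> real (card H) \<le> x}"

text \<open>
  Edges of a tripartite hypergraph on disjoint copies of \<open>U0\<close>, \<open>U1\<close>, \<open>U2\<close> are encoded as
  ordered triples; the position in the triple records the part a vertex belongs to.
\<close>

definition sum_hyperedges ::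
    "'a::ab_group_add set \<Rightarrow> 'a set \<Rightarrow> 'a set \<Rightarrow> ('a \<times> 'a \<times> 'a) set" where
  "sum_hyperedges U0 U1 U2 = {(c, a, b). c \<in> U0 \<and> a \<in> U1 \<and> b \<in> U2 \<and> c = a + b}"

end

theory Submission
  imports Defs "HOL-Library.FuncSet"
begin

text \<open>
  A container is read off a fingerprint \<open>X0 \<subseteq> A\<close>, \<open>X1 \<subseteq> B\<close>: with \<open>D = X0 + X1 \<subseteq> A + B\<close>, the part
  \<open>C0\<close> is the complement of \<open>D\<close>, and \<open>C1\<close>, \<open>C2\<close> contain only elements whose sums with \<open>X1\<close>,
  respectively \<open>X0\<close>, lie almost entirely in \<open>D\<close>. Adding to the fingerprint an element of \<open>A\<close> or \<open>B\<close>
  that violates this enlarges \<open>D\<close> by at least \<open>\<tau>\<close>, which happens at most \<open>m / \<tau>\<close> times. If many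
  pairs of \<open>C1 \<times> C2\<close> still have sums outside \<open>D\<close>, then either \<open>A\<close> has \<open>s\<close> elements of high degree,
  and adding these makes \<open>|C1| + |C2| - |D|\<close> drop by a constant multiple of \<open>\<epsilon>\<^sup>2 m\<close>, or it has
  fewer, and then all other elements of high degree can be discarded from \<open>C1\<close>, which ends the
  process. As \<open>|C1|, |C2| = O(m)\<close> after the first saturation, there are \<open>O(\<epsilon>\<^sup>-\<^sup>2)\<close> rounds, each
  costing \<open>s \<approx> \<surd>m\<close> elements.

  The size bound follows from Pollard's theorem for abelian groups, which is proved by Dyson
  transforms: they get stuck only if \<open>B\<close> lies in a coset of the stabilizer of \<open>A\<close>, and that is where
  \<open>\<beta>\<close> enters.
\<close>

section \<open>Pairs whose sum is missed\<close>

definition missed_degree :: "'a::ab_group_add set \<Rightarrow> 'a set \<Rightarrow> 'a \<Rightarrow> nat" where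
  "missed_degree D V a = card {b \<in> V. a + b \<notin> D}"

definition missed_pairs :: "'a::ab_group_add set \<Rightarrow> 'a set \<Rightarrow> 'a set \<Rightarrow> nat" where
  "missed_pairs D U V = card {(a, b) \<in> U \<times> V. a + b \<notin> D}"

definition low_degree :: "real \<Rightarrow> 'a::ab_group_add set \<Rightarrow> 'a set \<Rightarrow> 'a set \<Rightarrow> 'a set" where
  "low_degree c D V U = {a \<in> U. real (missed_degree D V a) \<le> c}"

lemma missed_degree_le_card: "finite V \<Longrightarrow> missed_degree D V a \<le> card V"
  unfolding missed_degree_def by (intro card_mono) auto

lemma missed_degree_mono:
  "finite V' \<Longrightarrow> V \<subseteq> V' \<Longrightarrow> D' \<subseteq> D \<Longrightarrow> missed_degree D V a \<le> missed_degree D' V' a"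
  unfolding missed_degree_def by (intro card_mono) auto

lemma missed_degree_le_add_card_Diff:
  assumes "finite V" "finite D'"
  shows "missed_degree D V a \<le> missed_degree D' V a + card (D' - D)"
proof -
  have "missed_degree D V a \<le> card ({b \<in> V. a + b \<notin> D'} \<union> {b \<in> V. a + b \<in> D' - D})"
    unfolding missed_degree_def using assms by (intro card_mono) auto
  also have "\<dots> \<le> missed_degree D' V a + card {b \<in> V. a + b \<in> D' - D}"
    unfolding missed_degree_def by (rule card_Un_le)
  also have "card {b \<in> V. a + b \<in> D' - D} \<le> card (D' - D)"
    by (intro card_inj_on_le[where f = "(+) a"]) (use assms in auto)
  finally show ?thesis by simp
qed

lemma card_insert_plus:
  assumes "finite X" "finite Z"
  shows "card (insert a X + Z) = card (X + Z) + missed_degree (X + Z) Z a"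
proof -
  have "insert a X + Z = (X + Z) \<union> (+) a ` {b \<in> Z. a + b \<notin> X + Z}"
    by (auto simp: set_plus_def)
  also have "card \<dots> = card (X + Z) + card ((+) a ` {b \<in> Z. a + b \<notin> X + Z})"
    using assms by (intro card_Un_disjoint finite_set_plus) auto
  finally show ?thesis
    by (simp add: missed_degree_def card_image)
qed

lemma missed_pairs_eq_sum:
  assumes "finite U" "finite V"
  shows "missed_pairs D U V = (\<Sum>a\<in>U. missed_degree D V a)"
proof -
  have "{(a, b) \<in> U \<times> V. a + b \<notin> D} = Sigma U (\<lambda>a. {b \<in> V. a + b \<notin> D})"
    by auto
  then show ?thesis
    using assms by (simp add: missed_pairs_def missed_degree_def)
qed

lemma missed_pairs_commute: "missed_pairs D U V = missed_pairs D V U"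
proof -
  have "bij_betw prod.swap {(a, b) \<in> U \<times> V. a + b \<notin> D} {(a, b) \<in> V \<times> U. a + b \<notin> D}"
    by (rule bij_betw_byWitness[where f' = prod.swap]) (auto simp: add.commute)
  then show ?thesis
    unfolding missed_pairs_def by (rule bij_betw_same_card)
qed

lemma missed_pairs_translate:
  "missed_pairs ((+) e ` D) U ((+) e ` V) = missed_pairs D U V"
proof -
  have "bij_betw (\<lambda>(a, b). (a, e + b)) {(a, b) \<in> U \<times> V. a + b \<notin> D}
      {(a, b) \<in> U \<times> (+) e ` V. a + b \<notin> (+) e ` D}"
    by (rule bij_betw_byWitness[where f' = "\<lambda>(a, b). (a, b - e)"])
      (auto simp: algebra_simps image_iff)
  then show ?thesis
    unfolding missed_pairs_def by (rule bij_betw_same_card[symmetric])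
qed

lemma missed_pairs_Un_disjoint:
  assumes "finite U" "finite U'" "finite V" "U \<inter> U' = {}"
  shows "missed_pairs D (U \<union> U') V = missed_pairs D U V + missed_pairs D U' V"
  using assms by (simp add: missed_pairs_eq_sum sum.union_disjoint)

lemma missed_pairs_Un_le:
  assumes "finite U" "finite U'" "finite V"
  shows "missed_pairs D (U \<union> U') V \<le> missed_pairs D U V + missed_pairs D U' V"
  using assms by (simp add: missed_pairs_eq_sum sum_Un_nat)

lemma missed_pairs_Int_Diff:
  assumes "finite U" "finite V"
  shows "missed_pairs D U V = missed_pairs D (U \<inter> W) V + missed_pairs D (U - W) V"
  using missed_pairs_Un_disjoint[of "U \<inter> W" "U - W" V D] assms
  by (simp add: Int_Diff_Un Int_Diff_disjoint)

lemma missed_pairs_le_if_missed_degree_le: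
  fixes c :: real
  assumes "finite U" "finite V" "\<And>a. a \<in> U \<Longrightarrow> real (missed_degree D V a) \<le> c"
  shows "real (missed_pairs D U V) \<le> c * card U"
proof -
  have "real (missed_pairs D U V) = (\<Sum>a\<in>U. real (missed_degree D V a))"
    using assms by (simp add: missed_pairs_eq_sum)
  also have "\<dots> \<le> (\<Sum>a\<in>U. c)" by (intro sum_mono assms)
  finally show ?thesis by (simp add: mult.commute)
qed

lemma missed_pairs_le_card_mult_card:
  assumes "finite U" "finite V"
  shows "missed_pairs D U V \<le> card U * card V"
  using missed_pairs_le_if_missed_degree_le[OF assms, of D "card V"] assms
  by (simp add: missed_degree_le_card mult.commute flip: of_nat_mult)

lemma missed_pairs_le_add_card_Diff:
  assumes "finite U" "finite V" "finite D'"
  shows "missed_pairs D U V \<le> missed_pairs D' U V + card U * card (D' - D)"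
proof -
  have "missed_pairs D U V \<le> (\<Sum>a\<in>U. missed_degree D' V a + card (D' - D))"
    using assms by (simp add: missed_pairs_eq_sum sum_mono missed_degree_le_add_card_Diff)
  then show ?thesis
    using assms by (simp add: missed_pairs_eq_sum sum.distrib)
qed

lemma card_mult_card_le:
  assumes "finite U" "finite V" "finite D"
  shows "card U * card V \<le> missed_pairs D U V + card U * card D"
proof -
  have "{(a, b) \<in> U \<times> V. a + b \<notin> {}} = U \<times> V" by auto
  then have "missed_pairs {} U V = card U * card V"
    by (simp only: missed_pairs_def card_cartesian_product)
  then show ?thesis
    using missed_pairs_le_add_card_Diff[OF assms, of "{}"] by simp
qed

lemma card_mult_card_le_if_missed_degree_le:
  fixes \<tau> :: real
  assumes "finite T" "finite W" "finite D" "\<And>b. b \<in> W \<Longrightarrow> real (missed_degree D T b) \<le> \<tau>"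
  shows "(card T - \<tau>) * card W \<le> real (card T * card D)"
proof -
  have "real (card T * card W) \<le> missed_pairs D W T + real (card T * card D)"
    using card_mult_card_le[OF assms(1-3)]
    by (simp only: missed_pairs_commute[of D W] flip: of_nat_add of_nat_le_iff)
  also have "real (missed_pairs D W T) \<le> \<tau> * card W"
    using assms by (intro missed_pairs_le_if_missed_degree_le)
  finally show ?thesis by (simp add: algebra_simps)
qed

section \<open>Pollard's theorem\<close>

definition stabilizer :: "'a::ab_group_add set \<Rightarrow> 'a set" where
  "stabilizer A = {h. \<forall>a\<in>A. a + h \<in> A}"

lemma add_subgroup_stabilizer:
  fixes A :: "'a::ab_group_add set"
  assumes "finite A"
  shows "add_subgroup (stabilizer A)"
proof -
  have "a + (- h) \<in> A" if "h \<in> stabilizer A" "a \<in> A" for h a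
  proof -
    have "(\<lambda>a. a + h) ` A = A"
      by (rule endo_inj_surj) (use assms that in \<open>auto simp: stabilizer_def inj_on_def\<close>)
    then obtain c where "c \<in> A" "a = c + h" using \<open>a \<in> A\<close> by auto
    then show ?thesis by simp
  qed
  then show ?thesis
    by (auto simp: add_subgroup_def stabilizer_def add.assoc[symmetric])
qed

lemma
  assumes "finite A" "A \<noteq> {}"
  shows finite_stabilizer: "finite (stabilizer A)"
    and card_stabilizer_le: "card (stabilizer A) \<le> card A"
proof -
  obtain a where "a \<in> A" using assms by auto
  then have "(+) a ` stabilizer A \<subseteq> A" by (auto simp: stabilizer_def)
  then show "finite (stabilizer A)" "card (stabilizer A) \<le> card A"
    using \<open>finite A\<close> inj_on_finite[of "(+) a"] card_inj_on_le[of "(+) a"] by auto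
qed

lemma card_le_card_stabilizer:
  fixes A B :: "'a::ab_group_add set"
  assumes "finite A" "A \<noteq> {}"
    and absorb: "\<And>e. A \<inter> (+) e ` B \<noteq> {} \<Longrightarrow> (+) e ` B \<subseteq> A"
  shows "card B \<le> card (stabilizer A)"
proof (cases "B = {}")
  case False
  then obtain b0 where b0: "b0 \<in> B" by auto
  have "b - b0 \<in> stabilizer A" if "b \<in> B" for b
    unfolding stabilizer_def
  proof clarify
    fix a assume "a \<in> A"
    then have "A \<inter> (+) (a - b0) ` B \<noteq> {}"
      using b0 by (auto simp: image_iff intro!: bexI[of _ b0])
    from absorb[OF this] that have "(a - b0) + b \<in> A" by blast
    then show "a + (b - b0) \<in> A" by (simp add: algebra_simps)
  qed
  then show ?thesis
    using finite_stabilizer[OF assms(1,2)]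
    by (intro card_inj_on_le[of "\<lambda>b. b - b0"]) (auto simp: inj_on_def)
qed simp

lemma card_le_beta:
  fixes H :: "'a::ab_group_add set"
  assumes "add_subgroup H" "finite H" "real (card H) \<le> x"
  shows "card H \<le> beta TYPE('a) x"
proof -
  have "{card H | H :: 'a set. add_subgroup H \<and> finite H \<and> real (card H) \<le> x} \<subseteq> {..nat \<lfloor>x\<rfloor>}"
    by (auto simp: le_nat_floor)
  then have "finite {card H | H :: 'a set. add_subgroup H \<and> finite H \<and> real (card H) \<le> x}"
    by (rule finite_subset) simp
  then show ?thesis
    unfolding beta_def by (rule Max_ge) (use assms in auto)
qed

text \<open>
  This is a dual form of Pollard's inequality: over all \<open>D\<close>, the right-hand side is minimised by
  the set of sums with at least \<open>t\<close> representations, where it counts every sum \<open>min t r\<close> times, \<open>r\<close>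
  being its number of representations.
\<close>

definition Pollard_bound :: "real \<Rightarrow> nat \<Rightarrow> 'a::ab_group_add set \<Rightarrow> 'a set \<Rightarrow> 'a set \<Rightarrow> bool" where
  "Pollard_bound x t A B D \<longleftrightarrow>
    real t * min x (real (card A) + real (card B) - real t - real (beta TYPE('a) x))
      \<le> real t * real (card D) + real (missed_pairs D A B)"

lemma Pollard_bound_translate:
  "Pollard_bound x t A ((+) e ` B) ((+) e ` D) \<longleftrightarrow> Pollard_bound x t A B D"
  by (simp add: Pollard_bound_def missed_pairs_translate card_image)

lemma missed_pairs_Dyson:
  assumes "finite A" "finite B"
  shows "missed_pairs D A B = missed_pairs D (A \<union> B) (A \<inter> B) + missed_pairs D (A - B) (B - A)"
proof -
  have "missed_pairs D A B = missed_pairs D (A \<inter> B) B + missed_pairs D (A - B) B"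
    using assms by (rule missed_pairs_Int_Diff)
  also have "missed_pairs D (A - B) B =
      missed_pairs D (A - B) (A \<inter> B) + missed_pairs D (A - B) (B - A)"
    using missed_pairs_Int_Diff[of B "A - B" D A] assms
    by (simp add: missed_pairs_commute Int_commute)
  also have "missed_pairs D (A \<inter> B) B = missed_pairs D B (A \<inter> B)"
    by (rule missed_pairs_commute)
  also have "missed_pairs D B (A \<inter> B) +
        (missed_pairs D (A - B) (A \<inter> B) + missed_pairs D (A - B) (B - A))
      = missed_pairs D (B \<union> (A - B)) (A \<inter> B) + missed_pairs D (A - B) (B - A)"
    using assms by (subst missed_pairs_Un_disjoint) auto
  also have "B \<union> (A - B) = A \<union> B" by auto
  finally show ?thesis .
qed

lemma Pollard_bound_if_Un_Int:
  assumes "finite A" "finite B" "Pollard_bound x t (A \<union> B) (A \<inter> B) D"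
  shows "Pollard_bound x t A B D"
proof -
  have "real (card (A \<union> B)) + real (card (A \<inter> B)) = real (card A) + real (card B)"
    using card_Un_Int[OF assms(1,2)] by simp
  then show ?thesis
    using assms by (simp add: Pollard_bound_def missed_pairs_Dyson[of A B])
qed

lemma mult_min_le_split:
  fixes t u N x d :: real
  assumes "0 \<le> u" "u \<le> t" "0 \<le> d"
  shows "t * min x (N - t - d) \<le> (t - u) * min x (N - u - t - d) + u * (N - u)"
proof (cases "x \<le> N - u - t - d")
  case True
  have "(t - u) * min x (N - t - d) \<le> (t - u) * x"
    using assms by (intro mult_left_mono) auto
  moreover have "u * min x (N - t - d) \<le> u * (N - u)"
    using assms by (intro mult_left_mono) auto
  ultimately show ?thesis using True by (simp add: algebra_simps)
next
  case False
  have "t * min x (N - t - d) \<le> t * (N - t - d)"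
    using assms by (intro mult_left_mono) auto
  also have "\<dots> \<le> (t - u) * (N - u - t - d) + u * (N - u)"
    using mult_nonneg_nonneg[OF assms(1,3)] by (simp add: algebra_simps)
  finally show ?thesis using False by simp
qed

lemma Pollard_bound_if_Diff:
  fixes A B D :: "'a::ab_group_add set"
  assumes fin: "finite A" "finite B" "finite D"
    and Int_le: "card (A \<inter> B) \<le> t"
    and Diff_Pollard_bound: "Pollard_bound x (t - card (A \<inter> B)) (A - B) (B - A) D"
  shows "Pollard_bound x t A B D"
proof -
  define u where "u = card (A \<inter> B)"
  define N where "N = real (card A) + real (card B)"
  define d where "d = real (beta TYPE('a) x)"
  have "u + card (A - B) = card A" "u + card (B - A) = card B"
    using card_Int_Diff[of A B] card_Int_Diff[of B A] fin by (simp_all add: u_def Int_commute)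
  then have cards: "real (card (A - B)) = card A - real u" "real (card (B - A)) = card B - real u"
    by linarith+
  have Diff_bound: "(real t - u) * min x (N - u - t - d)
      \<le> (real t - u) * card D + missed_pairs D (A - B) (B - A)"
    using Diff_Pollard_bound Int_le
    unfolding Pollard_bound_def u_def[symmetric] d_def[symmetric] cards
    by (simp add: N_def of_nat_diff algebra_simps)
  have "real (card (A \<union> B)) = N - u"
    using card_Un_Int[OF fin(1,2)] by (simp add: N_def u_def)
  moreover have "u * card (A \<union> B) \<le> missed_pairs D (A \<union> B) (A \<inter> B) + u * card D"
    using card_mult_card_le[of "A \<inter> B" "A \<union> B" D] fin by (simp add: u_def missed_pairs_commute)
  then have "real u * card (A \<union> B) \<le> missed_pairs D (A \<union> B) (A \<inter> B) + real u * card D"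
    by (simp flip: of_nat_mult of_nat_add)
  ultimately have "real u * (N - u) \<le> missed_pairs D (A \<union> B) (A \<inter> B) + real u * card D"
    by simp
  moreover have "real t * min x (N - t - d) \<le> (real t - u) * min x (N - u - t - d) + u * (N - u)"
    using Int_le by (intro mult_min_le_split) (auto simp: u_def d_def)
  ultimately show ?thesis
    using Diff_bound
    unfolding Pollard_bound_def missed_pairs_Dyson[OF fin(1,2)] N_def[symmetric] d_def[symmetric]
    by (simp add: algebra_simps)
qed

lemma mult_card_le_missed_pairs:
  assumes "finite A" "finite B" "finite D" "t \<le> card B"
  shows "t * card A \<le> t * card D + missed_pairs D A B"
proof -
  have "t * (card A - card D) \<le> card B * (card A - card D)"
    using assms by (intro mult_right_mono) auto
  also have "\<dots> \<le> missed_pairs D A B"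
    using card_mult_card_le[of B A D] assms by (simp add: missed_pairs_commute diff_mult_distrib2)
  finally show ?thesis by (simp add: diff_mult_distrib2)
qed

text \<open>When no Dyson transform is available, \<open>B\<close> lies in a coset of the stabilizer of \<open>A\<close>.\<close>

lemma Pollard_bound_if_translates_absorbed:
  fixes A B :: "'a::ab_group_add set"
  assumes fin: "finite A" "finite B" "finite D" and "A \<noteq> {}" "t \<le> card B"
    and absorb: "\<And>e. A \<inter> (+) e ` B \<noteq> {} \<Longrightarrow> (+) e ` B \<subseteq> A"
  shows "Pollard_bound x t A B D"
proof -
  have "x < card A \<or> card B \<le> beta TYPE('a) x"
    using card_le_beta[OF add_subgroup_stabilizer finite_stabilizer, of A x]
      card_le_card_stabilizer[OF fin(1) \<open>A \<noteq> {}\<close> absorb] card_stabilizer_le[of A] assms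
    by fastforce
  then have "real t * min x (real (card A) + real (card B) - real t - real (beta TYPE('a) x))
      \<le> real t * card A"
    by (intro mult_left_mono) auto
  also have "\<dots> \<le> real t * card D + missed_pairs D A B"
    using mult_card_le_missed_pairs[OF fin \<open>t \<le> card B\<close>]
    by (simp flip: of_nat_mult of_nat_add)
  finally show ?thesis unfolding Pollard_bound_def .
qed

lemma Pollard_bound_if_Dyson_transforms:
  fixes A B D :: "'a::ab_group_add set"
  assumes fin: "finite A" "finite B" "finite D" and t_le: "t \<le> card B" "card B \<le> card A"
    and B_not_sub: "A \<inter> B \<noteq> {}" "\<not> B \<subseteq> A"
    and bound: "\<And>A' B' t'. card B' < card B \<Longrightarrow> finite A' \<Longrightarrow> finite B' \<Longrightarrow>
      t' \<le> card B' \<Longrightarrow> card B' \<le> card A' \<Longrightarrow> Pollard_bound x t' A' B' D"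
  shows "Pollard_bound x t A B D"
proof -
  have "A \<inter> B \<subset> B" using B_not_sub by auto
  then have card_Int: "0 < card (A \<inter> B)" "card (A \<inter> B) < card B"
    using fin B_not_sub by (auto simp: card_gt_0_iff intro: psubset_card_mono)
  show ?thesis
  proof (cases "t \<le> card (A \<inter> B)")
    case True
    have "card A \<le> card (A \<union> B)" using fin by (intro card_mono) auto
    then have "Pollard_bound x t (A \<union> B) (A \<inter> B) D"
      using True card_Int t_le fin by (intro bound) auto
    then show ?thesis by (rule Pollard_bound_if_Un_Int[OF fin(1,2)])
  next
    case False
    have "card (A - B) = card A - card (A \<inter> B)" "card (B - A) = card B - card (A \<inter> B)"
      using fin by (auto simp: card_Diff_subset_Int Int_commute)
    then have "Pollard_bound x (t - card (A \<inter> B)) (A - B) (B - A) D"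
      using card_Int t_le fin by (intro bound) auto
    then show ?thesis
      using False by (intro Pollard_bound_if_Diff[OF fin]) auto
  qed
qed

theorem Pollard:
  fixes A B D :: "'a::ab_group_add set"
  assumes "finite A" "finite B" "finite D" "t \<le> card B" "card B \<le> card A"
  shows "Pollard_bound x t A B D"
  using assms
proof (induction "card B" arbitrary: A B D t rule: less_induct)
  case less
  consider (transform) e where "A \<inter> (+) e ` B \<noteq> {}" "\<not> (+) e ` B \<subseteq> A"
    | (empty) "A = {}"
    | (absorbed) "A \<noteq> {}" "\<And>e. A \<inter> (+) e ` B \<noteq> {} \<Longrightarrow> (+) e ` B \<subseteq> A"
    by blast
  then show ?case
  proof cases
    case transform
    have "Pollard_bound x t A ((+) e ` B) ((+) e ` D)"
    proof (rule Pollard_bound_if_Dyson_transforms[OF _ _ _ _ _ transform])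
      fix A' B' :: "'a set" and t'
      assume "card B' < card ((+) e ` B)" "finite A'" "finite B'" "t' \<le> card B'" "card B' \<le> card A'"
      then show "Pollard_bound x t' A' B' ((+) e ` D)"
        using less.prems by (intro less.hyps) (auto simp: card_image)
    qed (use less.prems in \<open>auto simp: card_image\<close>)
    then show ?thesis unfolding Pollard_bound_translate .
  next
    case empty
    then show ?thesis using less.prems by (simp add: Pollard_bound_def)
  next
    case absorbed
    then show ?thesis using less.prems by (intro Pollard_bound_if_translates_absorbed) auto
  qed
qed

lemma min_less_if_few_missed_pairs:
  fixes C1 C2 D :: "'a::ab_group_add set" and \<epsilon> m x :: real
  assumes "finite C1" "finite C2" "finite D" and ne: "C1 \<noteq> {}" "C2 \<noteq> {}"
    and "card C2 \<le> card C1" and eps: "0 < \<epsilon>" "\<epsilon> \<le> 1"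
    and card_D: "card D \<le> m" and few: "missed_pairs D C1 C2 < \<epsilon>\<^sup>2 * card C1 * card C2"
  shows "min x (real (card C1) + real (card C2) - (\<epsilon> * card C2 + 1) - beta TYPE('a) x)
    < m + \<epsilon> * card C1"
proof -
  define t where "t = nat \<lceil>\<epsilon> * card C2\<rceil>"
  have "card C2 > 0" using ne assms by (simp add: card_gt_0_iff)
  then have t_bounds: "\<epsilon> * card C2 \<le> t" "t < \<epsilon> * card C2 + 1" "t > 0"
    using eps by (auto simp: t_def) linarith
  have "\<epsilon> * card C2 \<le> card C2" using eps by (simp add: mult_left_le_one_le)
  then have "t \<le> card C2" by (simp add: t_def ceiling_le_iff nat_le_iff)
  then have "real t * min x (real (card C1) + card C2 - t - beta TYPE('a) x)
      \<le> real t * card D + missed_pairs D C1 C2"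
    using Pollard[of C1 C2 D t x] assms by (simp add: Pollard_bound_def)
  also have "\<dots> < real t * m + \<epsilon>\<^sup>2 * card C1 * card C2"
    using card_D few by (intro add_le_less_mono mult_left_mono) auto
  also have "\<epsilon>\<^sup>2 * card C1 * card C2 = \<epsilon> * card C1 * (\<epsilon> * card C2)"
    by (simp add: power2_eq_square)
  also have "\<dots> \<le> \<epsilon> * card C1 * t" using t_bounds eps by (intro mult_left_mono) auto
  finally have "real t * min x (real (card C1) + card C2 - t - beta TYPE('a) x)
      < real t * (m + \<epsilon> * card C1)"
    by (simp add: algebra_simps)
  then have "min x (real (card C1) + card C2 - t - beta TYPE('a) x) < m + \<epsilon> * card C1"
    using t_bounds by simp
  then show ?thesis using t_bounds(2) by linarith
qed

lemma card_le_if_few_missed_pairs: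
  fixes \<delta> m :: real
  assumes fin: "finite U" "finite V" "finite D" and "V \<noteq> {}" and card_D: "card D \<le> m"
    and few: "missed_pairs D U V \<le> \<delta> * card U * card V"
  shows "(1 - \<delta>) * card U \<le> m"
proof -
  have "real (card V * card U) \<le> missed_pairs D U V + real (card V * card D)"
    using card_mult_card_le[OF fin(2,1,3)]
    by (simp only: missed_pairs_commute[of D U] flip: of_nat_add of_nat_le_iff)
  also have "\<dots> \<le> \<delta> * card U * card V + card V * m"
    using few card_D by (intro add_mono) (auto intro: mult_left_mono)
  finally have "card V * ((1 - \<delta>) * card U) \<le> card V * m" by (simp add: algebra_simps)
  moreover have "0 < card V" using fin \<open>V \<noteq> {}\<close> by (simp add: card_gt_0_iff)
  ultimately show ?thesis by simp
qed

lemma card_add_card_le_if_few_missed_pairs: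
  fixes C1 C2 D :: "'a::ab_group_add set" and \<epsilon> m :: real
  assumes eps: "0 < \<epsilon>" "\<epsilon> < 1 / 4" and fin: "finite C1" "finite C2" "finite D"
    and card_D: "card D \<le> m" and large: "3 / \<epsilon> \<le> real (card C1) + real (card C2)"
    and few: "missed_pairs D C1 C2 < \<epsilon>\<^sup>2 * card C1 * card C2"
  shows "real (card C1) + real (card C2) \<le> (1 + 2 * \<epsilon>) * (m + beta TYPE('a) ((1 + 4 * \<epsilon>) * m))"
  using fin large few
proof (induction "card C2" "card C1" arbitrary: C1 C2 rule: linorder_wlog)
  case sym
  have "real (card C2) + real (card C1) \<le> (1 + 2 * \<epsilon>) * (m + beta TYPE('a) ((1 + 4 * \<epsilon>) * m))"
    by (rule sym.hyps) (use sym.prems in \<open>auto simp: missed_pairs_commute mult_ac\<close>)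
  then show ?case by simp
next
  case le
  define N where "N = real (card C1) + real (card C2)"
  define d where "d = real (beta TYPE('a) ((1 + 4 * \<epsilon>) * m))"
  have ne: "C1 \<noteq> {}" "C2 \<noteq> {}" using le.prems by auto
  have "\<epsilon>\<^sup>2 \<le> (1 / 4)\<^sup>2" using eps by (intro power_mono) auto
  then have "card C1 * (3 / 4) \<le> (1 - \<epsilon>\<^sup>2) * card C1"
    by (subst mult.commute, intro mult_right_mono) (auto simp: power2_eq_square)
  also have "\<dots> \<le> m"
    using le.prems ne card_D by (intro card_le_if_few_missed_pairs[of C1 C2 D]) auto
  finally have "\<epsilon> * card C1 \<le> \<epsilon> * (4 * m)" using eps by (intro mult_left_mono) auto
  then have "m + \<epsilon> * card C1 \<le> (1 + 4 * \<epsilon>) * m" by (simp add: algebra_simps)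
  with min_less_if_few_missed_pairs[OF le.prems(1-3) ne le.hyps eps(1) _ card_D le.prems(5),
      of "(1 + 4 * \<epsilon>) * m"]
  have "N - (\<epsilon> * card C2 + 1) - d < m + \<epsilon> * card C1"
    using eps by (auto simp: N_def d_def min_less_iff_disj)
  then have "(1 - \<epsilon>) * N - 1 \<le> m + d" by (simp add: N_def algebra_simps)
  moreover have "1 \<le> \<epsilon> / 3 * N" using le.prems eps by (simp add: N_def field_simps)
  ultimately have "(1 - 4 / 3 * \<epsilon>) * N \<le> m + d" by (simp add: algebra_simps)
  then have "(1 + 2 * \<epsilon>) * ((1 - 4 / 3 * \<epsilon>) * N) \<le> (1 + 2 * \<epsilon>) * (m + d)"
    using eps by (intro mult_left_mono) auto
  moreover have "(1 + 2 * \<epsilon>) * ((1 - 4 / 3 * \<epsilon>) * N) = N + 8 / 3 * (\<epsilon> * (1 / 4 - \<epsilon>)) * N"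
    by (simp add: field_simps)
  moreover have "0 \<le> 8 / 3 * (\<epsilon> * (1 / 4 - \<epsilon>)) * N" using eps by (simp add: N_def)
  ultimately show ?case unfolding N_def d_def by linarith
qed

section \<open>Fingerprints\<close>

text \<open>
  The two summands are indexed by \<^typ>\<open>bool\<close>, so that a statement about one of them covers both:
  the other index is the negation.
\<close>

type_synonym 'a sides = "bool \<Rightarrow> 'a set"

definition sumset :: "'a::ab_group_add sides \<Rightarrow> 'a set" where
  "sumset X = X False + X True"

definition total_card :: "'a sides \<Rightarrow> nat" where
  "total_card X = card (X False) + card (X True)"

abbreviation one_side :: "bool \<Rightarrow> 'a set \<Rightarrow> 'a sides" where
  "one_side i F \<equiv> (\<lambda>_. {})(i := F)"

lemma sumset_eq: "sumset X = X i + X (\<not> i)"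
  by (cases i) (simp_all add: sumset_def add.commute)

lemma total_card_eq: "total_card X = card (X i) + card (X (\<not> i))"
  by (cases i) (simp_all add: total_card_def)

lemma missed_pairs_sides:
  "missed_pairs D (X False) (X True) = missed_pairs D (X i) (X (\<not> i))"
  by (cases i) (simp_all add: missed_pairs_commute)

lemma sumset_mono: "X \<le> X' \<Longrightarrow> sumset X \<subseteq> sumset X'"
  unfolding sumset_def by (intro set_plus_mono2) (auto simp: le_fun_def)

lemma finite_sides_le:
  fixes X A :: "'a sides"
  assumes "X \<le> A" "\<And>i. finite (A i)"
  shows "finite (X i)"
  by (rule finite_subset[OF le_funD[OF assms(1)] assms(2)])

lemma finite_sumset: "(\<And>i. finite (X i)) \<Longrightarrow> finite (sumset X)"
  by (simp add: sumset_def finite_set_plus)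

lemma card_sumset_mono: "X \<le> X' \<Longrightarrow> (\<And>i. finite (X' i)) \<Longrightarrow> card (sumset X) \<le> card (sumset X')"
  by (intro card_mono finite_sumset sumset_mono)

lemma total_card_mono:
  assumes "X \<le> X'" "\<And>i. finite (X' i)"
  shows "total_card X \<le> total_card X'"
  using assms unfolding total_card_def le_fun_def by (intro add_mono card_mono) auto

lemma total_card_sup_le: "total_card (sup X F) \<le> total_card X + total_card F"
  using add_mono[OF card_Un_le[of "X False" "F False"] card_Un_le[of "X True" "F True"]]
  by (simp add: total_card_def)

lemma total_card_one_side: "total_card (one_side i F) = card F"
  by (simp add: total_card_eq[of _ i])

text \<open>
  Take \<open>X'\<close> maximising \<open>|sumset X'| - \<tau> |X'|\<close>: one more element cannot enlarge the sumset by more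
  than \<open>\<tau>\<close>.
\<close>

lemma saturated_extension:
  fixes X A :: "'a::ab_group_add sides" and \<tau> :: real
  assumes fin: "\<And>i. finite (A i)" and "X \<le> A" and "0 < \<tau>"
  obtains X' where "X \<le> X'" "X' \<le> A"
    "\<And>i a. a \<in> A i \<Longrightarrow> missed_degree (sumset X') (X' (\<not> i)) a \<le> \<tau>"
    "total_card X' \<le> total_card X + (real (card (sumset X')) - card (sumset X)) / \<tau>"
proof -
  define gain where "gain X' = card (sumset X') - \<tau> * total_card X'" for X' :: "'a sides"
  have "{X'. X \<le> X' \<and> X' \<le> A} \<subseteq> (\<Pi>\<^sub>E i\<in>UNIV. Pow (A i))"
    by (auto simp: le_fun_def)
  then have "finite {X'. X \<le> X' \<and> X' \<le> A}"
    by (rule finite_subset) (use fin in \<open>auto intro: finite_PiE\<close>)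
  moreover have "{X'. X \<le> X' \<and> X' \<le> A} \<noteq> {}" using \<open>X \<le> A\<close> by auto
  ultimately obtain X' where X': "X \<le> X'" "X' \<le> A"
    and max: "\<And>X''. X \<le> X'' \<Longrightarrow> X'' \<le> A \<Longrightarrow> gain X'' \<le> gain X'"
    by (metis (mono_tags, lifting) obtains_MAX[of _ gain] Max_ge finite_imageI imageI
        mem_Collect_eq)
  have finX': "finite (X' i)" for i using X'(2) fin by (rule finite_sides_le)
  show thesis
  proof (rule that[OF X'])
    fix i a assume a_in_A: "a \<in> A i"
    define X'' where "X'' = X'(i := insert a (X' i))"
    have "gain X'' \<le> gain X'"
      using a_in_A X' by (intro max) (auto simp: X''_def le_fun_def)
    moreover have "card (sumset X'') = card (sumset X') + missed_degree (sumset X') (X' (\<not> i)) a"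
      using card_insert_plus[OF finX' finX'] by (simp add: X''_def sumset_eq[of _ i])
    moreover have "total_card X'' \<le> total_card X' + 1"
      using finX' by (simp add: X''_def total_card_eq[of _ i] card_insert_if)
    then have "\<tau> * total_card X'' \<le> \<tau> * (total_card X' + 1)"
      using \<open>0 < \<tau>\<close> by (intro mult_left_mono) linarith+
    ultimately show "missed_degree (sumset X') (X' (\<not> i)) a \<le> \<tau>"
      by (simp add: gain_def algebra_simps)
  next
    have "gain X \<le> gain X'" using \<open>X \<le> A\<close> by (intro max) auto
    then show "total_card X' \<le> total_card X + (real (card (sumset X')) - card (sumset X)) / \<tau>"
      using \<open>0 < \<tau>\<close> by (simp add: gain_def field_simps)
  qed
qed

lemma high_degree_progress:
  fixes \<tau> \<theta> :: real
  assumes fin: "finite F" "finite V" "finite D" "finite D'" and "V' \<subseteq> V" "D \<subseteq> D'" "0 \<le> \<tau>"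
    and high: "\<And>a. a \<in> F \<Longrightarrow> \<theta> * card V \<le> missed_degree D V a"
    and low: "\<And>b. b \<in> V' \<Longrightarrow> missed_degree D' F b \<le> \<tau>"
  shows "(\<theta> * card F - \<tau>) * card V
    \<le> card F * (real (card D') - card D + (real (card V) - card V'))"
proof -
  have finV': "finite V'" using \<open>V' \<subseteq> V\<close> fin finite_subset by blast
  have "\<theta> * card F * card V = (\<Sum>a\<in>F. \<theta> * card V)" by simp
  also have "\<dots> \<le> (\<Sum>a\<in>F. real (missed_degree D V a))" by (intro sum_mono high)
  also have "\<dots> = missed_pairs D F V" using fin by (simp add: missed_pairs_eq_sum)
  also have "missed_pairs D F V = missed_pairs D F V' + missed_pairs D F (V - V')"
    using missed_pairs_Int_Diff[of V F D V'] fin \<open>V' \<subseteq> V\<close>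
    by (simp add: missed_pairs_commute Int_absorb1)
  also have "missed_pairs D F V' \<le> missed_pairs D' F V' + card F * card (D' - D)"
    using fin finV' by (intro missed_pairs_le_add_card_Diff)
  also have "missed_pairs D F (V - V') \<le> card F * card (V - V')"
    using fin by (intro missed_pairs_le_card_mult_card) auto
  finally have "\<theta> * card F * card V
      \<le> missed_pairs D' F V' + card F * (real (card (D' - D)) + card (V - V'))"
    by (simp add: algebra_simps)
  moreover have "real (missed_pairs D' F V') \<le> \<tau> * card V'"
    unfolding missed_pairs_commute[of D' F]
    using fin finV' low by (intro missed_pairs_le_if_missed_degree_le)
  moreover have "\<tau> * card V' \<le> \<tau> * card V"
    using \<open>V' \<subseteq> V\<close> \<open>0 \<le> \<tau>\<close> fin by (intro mult_left_mono) (auto intro: card_mono)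
  moreover have "real (card (D' - D)) = real (card D') - card D"
    "real (card (V - V')) = real (card V) - card V'"
    using assms finV' by (auto simp: card_Diff_subset card_mono of_nat_diff)
  ultimately show ?thesis by (simp add: algebra_simps)
qed

lemma few_missed_pairs_if_low_degree:
  fixes D W X F V :: "'a::ab_group_add set" and \<tau> \<theta> :: real
  assumes fin: "finite W" "finite X" "finite F" "finite V" and "V \<noteq> {}" "0 \<le> \<theta>"
    and low: "\<And>a. a \<in> W \<Longrightarrow> missed_degree D V a \<le> \<theta> * card V"
    and sat: "\<And>b. b \<in> V \<Longrightarrow> missed_degree D X b \<le> \<tau>"
    and small: "card F + \<tau> < \<theta> * card (W \<union> (X \<union> F))"
  shows "missed_pairs D (W \<union> (X \<union> F)) V < 2 * \<theta> * card (W \<union> (X \<union> F)) * card V"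
proof -
  have "missed_pairs D (W \<union> (X \<union> F)) V
      \<le> missed_pairs D W V + (missed_pairs D X V + missed_pairs D F V)"
    using missed_pairs_Un_le[of W "X \<union> F" V D] missed_pairs_Un_le[of X F V D] fin by simp
  moreover have "real (missed_pairs D W V) \<le> \<theta> * card V * card W"
    using fin low by (intro missed_pairs_le_if_missed_degree_le)
  moreover have "real (missed_pairs D X V) \<le> \<tau> * card V"
    unfolding missed_pairs_commute[of D X]
    using fin sat by (intro missed_pairs_le_if_missed_degree_le)
  moreover have "missed_pairs D F V \<le> card F * card V"
    using fin by (intro missed_pairs_le_card_mult_card)
  then have "real (missed_pairs D F V) \<le> real (card F) * card V"
    by (simp flip: of_nat_mult)
  ultimately have "missed_pairs D (W \<union> (X \<union> F)) V \<le> (\<theta> * card W + (card F + \<tau>)) * card V"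
    by (simp add: algebra_simps)
  also have "\<dots> < (\<theta> * card (W \<union> (X \<union> F)) + \<theta> * card (W \<union> (X \<union> F))) * card V"
  proof (intro mult_strict_right_mono add_le_less_mono small)
    show "\<theta> * card W \<le> \<theta> * card (W \<union> (X \<union> F))"
      using fin \<open>0 \<le> \<theta>\<close> by (intro mult_left_mono) (auto intro: card_mono)
    show "0 < real (card V)" using fin \<open>V \<noteq> {}\<close> by (simp add: card_gt_0_iff)
  qed
  finally show ?thesis by (simp add: algebra_simps)
qed

text \<open>
  In a state \<open>(X, U)\<close>, the set \<open>X i\<close> consists of the elements of the \<open>i\<close>-th summand read so far and
  \<open>U i\<close> is its current container. The letter \<open>Idle\<close> pads words to a common length.
\<close>

datatype 'a letter = Insert bool 'a | Saturate | Prune bool | Idle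

type_synonym 'a state = "'a sides \<times> 'a sides"

fun transition :: "real \<Rightarrow> real \<Rightarrow> 'a::ab_group_add state \<Rightarrow> 'a letter \<Rightarrow> 'a state" where
  "transition \<tau> \<theta> (X, U) (Insert i y) = (X(i := insert y (X i)), U)"
| "transition \<tau> \<theta> (X, U) Saturate =
    (X, \<lambda>i. low_degree \<tau> (sumset X) (X (\<not> i)) (U i))"
| "transition \<tau> \<theta> (X, U) (Prune i) =
    (X, U(i := low_degree (\<theta> * card (U (\<not> i))) (sumset X) (U (\<not> i)) (U i) \<union> X i))"
| "transition \<tau> \<theta> \<sigma> Idle = \<sigma>"

definition letters :: "'a set \<Rightarrow> 'a letter set" where
  "letters Y = case_prod Insert ` (UNIV \<times> Y) \<union> {Saturate, Prune False, Prune True, Idle}"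

primrec states :: "real \<Rightarrow> real \<Rightarrow> 'a::ab_group_add set \<Rightarrow> nat \<Rightarrow> 'a state set" where
  "states \<tau> \<theta> Y 0 = {(\<lambda>_. {}, \<lambda>_. Y)}"
| "states \<tau> \<theta> Y (Suc k) = case_prod (transition \<tau> \<theta>) ` (states \<tau> \<theta> Y k \<times> letters Y)"

lemma in_letters:
  "Insert i y \<in> letters Y \<longleftrightarrow> y \<in> Y" "Saturate \<in> letters Y" "Prune i \<in> letters Y" "Idle \<in> letters Y"
  by (cases i; auto simp: letters_def)+

lemma finite_letters: "finite Y \<Longrightarrow> finite (letters Y)"
  by (simp add: letters_def)

lemma card_letters_le:
  assumes "finite Y"
  shows "card (letters Y) \<le> 2 * card Y + 4"
proof -
  have "card (letters Y) \<le> card (case_prod Insert ` (UNIV \<times> Y))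
      + card {Saturate, Prune False, Prune True, Idle :: 'a letter}"
    unfolding letters_def by (rule card_Un_le)
  also have "card (case_prod Insert ` (UNIV \<times> Y)) \<le> card (UNIV \<times> Y :: (bool \<times> 'a) set)"
    using assms by (intro card_image_le) simp
  finally show ?thesis by (simp add: card_cartesian_product)
qed

lemma finite_states: "finite Y \<Longrightarrow> finite (states \<tau> \<theta> Y k)"
  by (induction k) (simp_all add: finite_letters)

lemma card_states_le:
  assumes "finite Y"
  shows "card (states \<tau> \<theta> Y k) \<le> (2 * card Y + 4) ^ k"
proof (induction k)
  case (Suc k)
  have "card (states \<tau> \<theta> Y (Suc k)) \<le> card (states \<tau> \<theta> Y k \<times> letters Y)"
    unfolding states.simps by (intro card_image_le) (simp add: assms finite_states finite_letters)
  also have "\<dots> \<le> (2 * card Y + 4) ^ k * (2 * card Y + 4)"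
    unfolding card_cartesian_product by (intro mult_mono Suc card_letters_le assms) auto
  finally show ?case by (simp add: mult.commute)
qed simp

lemma transition_in_states:
  "\<sigma> \<in> states \<tau> \<theta> Y k \<Longrightarrow> l \<in> letters Y \<Longrightarrow> transition \<tau> \<theta> \<sigma> l \<in> states \<tau> \<theta> Y (Suc k)"
  by force

lemma states_mono:
  assumes "k \<le> l"
  shows "states \<tau> \<theta> Y k \<subseteq> states \<tau> \<theta> Y l"
  using assms
proof (induction l rule: dec_induct)
  case (step l)
  have "states \<tau> \<theta> Y l \<subseteq> states \<tau> \<theta> Y (Suc l)"
    using transition_in_states[of _ \<tau> \<theta> Y l Idle] by (auto simp: in_letters)
  with step.IH show ?case by (rule subset_trans)
qed simp

lemma states_insert_set:
  assumes "finite F" "F \<subseteq> Y" "(X, U) \<in> states \<tau> \<theta> Y k"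
  shows "(X(i := X i \<union> F), U) \<in> states \<tau> \<theta> Y (k + card F)"
  using assms(1,2)
proof (induction F)
  case (insert y F)
  then have "(X(i := X i \<union> F), U) \<in> states \<tau> \<theta> Y (k + card F)" by blast
  moreover have "Insert i y \<in> letters Y" using insert.prems by (simp add: in_letters)
  ultimately have in_states:
    "transition \<tau> \<theta> (X(i := X i \<union> F), U) (Insert i y) \<in> states \<tau> \<theta> Y (Suc (k + card F))"
    by (rule transition_in_states)
  have "transition \<tau> \<theta> (X(i := X i \<union> F), U) (Insert i y) = (X(i := X i \<union> insert y F), U)"
    by simp
  moreover have "Suc (k + card F) = k + card (insert y F)" using insert.hyps by simp
  ultimately show ?case using in_states by (simp only:)
qed (use assms(3) in simp)

lemma states_extend:
  assumes "finite Y" "(X, U) \<in> states \<tau> \<theta> Y k" "X \<le> X'" "X' \<le> (\<lambda>_. Y)"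
  shows "(X', U) \<in> states \<tau> \<theta> Y (k + (total_card X' - total_card X))"
proof -
  have sub: "X i \<subseteq> X' i" "X' i \<subseteq> Y" "finite (X' i)" for i
    using assms finite_subset[of "X' i" Y] by (auto simp: le_fun_def)
  define F where "F i = X' i - X i" for i
  have F_props: "finite (F i)" "F i \<subseteq> Y" "X i \<union> F i = X' i"
    "card (F i) = card (X' i) - card (X i)" for i
    using sub[of i] by (auto simp: F_def card_Diff_subset finite_subset)
  have "X(False := X False \<union> F False, True := X True \<union> F True) = X'"
    using F_props(3) by (auto simp: fun_eq_iff all_bool_eq)
  moreover have "(X(False := X False \<union> F False), U) \<in> states \<tau> \<theta> Y (k + card (F False))"
    by (rule states_insert_set[OF F_props(1,2) assms(2)])
  from states_insert_set[OF F_props(1,2) this, of True True]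
  have "(X(False := X False \<union> F False, True := X True \<union> F True), U)
      \<in> states \<tau> \<theta> Y (k + card (F False) + card (F True))"
    by simp
  moreover have "card (F False) + card (F True) = total_card X' - total_card X"
    using sub by (simp add: F_props(4) total_card_def card_mono)
  ultimately show ?thesis by (simp add: add.assoc)
qed

section \<open>Containers for a fixed pair\<close>

definition sparse :: "real \<Rightarrow> real \<Rightarrow> 'a::ab_group_add set \<times> 'a set \<times> 'a set \<Rightarrow> bool" where
  "sparse \<mu> \<delta> = (\<lambda>(C0, C1, C2). (real (card C1) \<le> \<mu> \<and> real (card C2) \<le> \<mu>) \<or>
    real (card (sum_hyperedges C0 C1 C2)) < \<delta> * real (card C1) * real (card C2))"

definition container :: "'a::ab_group_add set \<Rightarrow> 'a state \<Rightarrow> 'a set \<times> 'a set \<times> 'a set" where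
  "container Y = (\<lambda>(X, U). ((Y + Y) - sumset X, U False, U True))"

lemma card_sum_hyperedges:
  assumes "U \<subseteq> Y" "V \<subseteq> Y"
  shows "card (sum_hyperedges ((Y + Y) - D) U V) = missed_pairs D U V"
proof -
  have "bij_betw snd (sum_hyperedges ((Y + Y) - D) U V) {(a, b) \<in> U \<times> V. a + b \<notin> D}"
    by (rule bij_betw_byWitness[where f' = "\<lambda>(a, b). (a + b, a, b)"])
      (use assms in \<open>auto simp: sum_hyperedges_def intro!: set_plus_intro\<close>)
  then show ?thesis unfolding missed_pairs_def by (rule bij_betw_same_card)
qed

lemma sparse_container_iff:
  fixes \<mu> \<delta> :: real
  assumes "U \<le> (\<lambda>_. Y)"
  shows "sparse \<mu> \<delta> (container Y (X, U)) \<longleftrightarrow> (\<forall>i. card (U i) \<le> \<mu>) \<or>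
    missed_pairs (sumset X) (U False) (U True) < \<delta> * card (U False) * card (U True)"
  using card_sum_hyperedges[of "U False" Y "U True"] assms
  by (auto simp: sparse_def container_def le_fun_def all_bool_eq)

locale summand_pair =
  fixes Y :: "'a::ab_group_add set" and A :: "'a sides" and s :: nat and \<theta> \<mu> :: real
  assumes finite_Y: "finite Y" and A_le_Y: "A \<le> (\<lambda>_. Y)"
    and s_pos: "0 < s" and s_le_card: "\<And>i. s \<le> card (A i)"
    and \<theta>_pos: "0 < \<theta>" and \<theta>_le_1: "\<theta> \<le> 1" and \<mu>_pos: "0 < \<mu>"
begin

definition \<tau> :: real where "\<tau> = \<theta> * s / 2"

definition reachable :: "nat \<Rightarrow> 'a sides \<Rightarrow> 'a sides \<Rightarrow> bool" where
  "reachable k X U \<longleftrightarrow> (X, U) \<in> states \<tau> \<theta> Y k \<and> X \<le> A \<and> A \<le> U \<and> U \<le> (\<lambda>_. Y)"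

definition saturated :: "'a sides \<Rightarrow> 'a sides \<Rightarrow> bool" where
  "saturated X U \<longleftrightarrow> (\<forall>i. \<forall>a\<in>U i. missed_degree (sumset X) (X (\<not> i)) a \<le> \<tau>)"

definition container_within :: "nat \<Rightarrow> bool" where
  "container_within k \<longleftrightarrow> (\<exists>X U. reachable k X U \<and> sparse \<mu> (2 * \<theta>) (container Y (X, U)))"

definition potential :: "'a sides \<Rightarrow> 'a sides \<Rightarrow> real" where
  "potential X U = real (total_card U) - real (card (sumset X))"

lemma \<tau>_pos: "0 < \<tau>"
  using \<theta>_pos s_pos by (simp add: \<tau>_def)

lemma finite_A: "finite (A i)"
  using A_le_Y finite_Y by (rule finite_sides_le)

lemma reachable_start: "reachable 0 (\<lambda>_. {}) (\<lambda>_. Y)"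
  using A_le_Y by (auto simp: reachable_def le_fun_def)

lemma reachable_finite_fingerprint: "reachable k X U \<Longrightarrow> finite (X i)"
  unfolding reachable_def by (elim conjE finite_sides_le[of X]) (rule finite_A)

lemma reachable_finite_container: "reachable k X U \<Longrightarrow> finite (U i)"
  unfolding reachable_def by (elim conjE finite_sides_le[of U]) (rule finite_Y)

lemma reachable_card_sumset_le: "reachable k X U \<Longrightarrow> card (sumset X) \<le> card (sumset A)"
  unfolding reachable_def by (intro card_sumset_mono finite_A) simp

lemma reachable_slack_nonneg:
  assumes "reachable k X U"
  shows "0 \<le> (real (card (sumset A)) - card (sumset X)) / \<tau>"
  using reachable_card_sumset_le[OF assms] \<tau>_pos by simp

lemma saturatedD:
  assumes "saturated X U" "b \<in> U (\<not> i)"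
  shows "missed_degree (sumset X) (X i) b \<le> \<tau>"
proof -
  have "\<forall>a\<in>U (\<not> i). missed_degree (sumset X) (X (\<not> \<not> i)) a \<le> \<tau>"
    using assms(1) unfolding saturated_def by (rule spec)
  then show ?thesis using assms(2) by simp
qed

lemma container_within_mono: "container_within k \<Longrightarrow> k \<le> l \<Longrightarrow> container_within l"
  using states_mono[of k l \<tau> \<theta> Y] by (auto simp: container_within_def reachable_def)

lemma reachable_saturated:
  assumes reach: "reachable k X U" and "F \<le> A"
  obtains k' X' U' where "reachable k' X' U'" "saturated X' U'" "sup X F \<le> X'" "U' \<le> U"
    "real k' \<le> k + total_card F + 1 + (real (card (sumset X')) - card (sumset X)) / \<tau>"
proof -
  have "sup X F \<le> A" using reach \<open>F \<le> A\<close> by (simp add: reachable_def)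
  then obtain X' where X': "sup X F \<le> X'" "X' \<le> A"
    and low: "\<And>i a. a \<in> A i \<Longrightarrow> missed_degree (sumset X') (X' (\<not> i)) a \<le> \<tau>"
    and cost: "total_card X'
      \<le> total_card (sup X F) + (real (card (sumset X')) - card (sumset (sup X F))) / \<tau>"
    by (rule saturated_extension[OF finite_A _ \<tau>_pos]) (rule that)
  have finX': "finite (X' i)" for i using X'(2) finite_A by (rule finite_sides_le)
  have "X \<le> X'" "X' \<le> (\<lambda>_. Y)" using X' A_le_Y by auto
  define U' where "U' i = low_degree \<tau> (sumset X') (X' (\<not> i)) (U i)" for i
  define k' where "k' = k + (total_card X' - total_card X) + 1"
  have "(X', U) \<in> states \<tau> \<theta> Y (k + (total_card X' - total_card X))"
    using reach \<open>X \<le> X'\<close> \<open>X' \<le> (\<lambda>_. Y)\<close> finite_Y by (intro states_extend) (auto simp: reachable_def)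
  then have "(X', U') \<in> states \<tau> \<theta> Y k'"
    using transition_in_states[of "(X', U)" \<tau> \<theta> Y _ Saturate]
    by (simp add: in_letters k'_def U'_def[abs_def])
  moreover have "A \<le> U'" "U' \<le> U"
    using reach low by (auto simp: reachable_def U'_def low_degree_def le_fun_def)
  ultimately have "reachable k' X' U'"
    using reach X' by (auto simp: reachable_def)
  moreover have "saturated X' U'" by (auto simp: saturated_def U'_def low_degree_def)
  moreover have "real k' \<le> k + total_card F + 1 + (real (card (sumset X')) - card (sumset X)) / \<tau>"
  proof -
    have "finite (sup X F i)" for i using X'(1) finX' by (rule finite_sides_le)
    then have "card (sumset X) \<le> card (sumset (sup X F))" by (intro card_sumset_mono) auto
    then have "(real (card (sumset X')) - card (sumset (sup X F))) / \<tau>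
        \<le> (real (card (sumset X')) - card (sumset X)) / \<tau>"
      using \<tau>_pos by (intro divide_right_mono) auto
    moreover have "total_card X \<le> total_card X'" using \<open>X \<le> X'\<close> finX' by (rule total_card_mono)
    ultimately show ?thesis
      using cost total_card_sup_le[of X F] by (simp add: k'_def of_nat_diff)
  qed
  ultimately show thesis using that X'(1) \<open>U' \<le> U\<close> by blast
qed

lemma reachable_prune:
  assumes reach: "reachable k X U" and F_sub: "F \<subseteq> A i"
    and high: "\<And>a. a \<in> A i \<Longrightarrow> \<theta> * card (U (\<not> i)) < missed_degree (sumset X) (U (\<not> i)) a
      \<Longrightarrow> a \<in> X i \<union> F"
  defines "X' \<equiv> X(i := X i \<union> F)"
  defines "W \<equiv> low_degree (\<theta> * card (U (\<not> i))) (sumset X') (U (\<not> i)) (U i)"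
  shows "reachable (k + card F + 1) X' (U(i := W \<union> (X i \<union> F)))"
proof -
  have sub: "X j \<subseteq> A j" "A j \<subseteq> U j" "U j \<subseteq> Y" "A j \<subseteq> Y" for j
    using reach A_le_Y by (auto simp: reachable_def le_fun_def)
  have "(X', U) \<in> states \<tau> \<theta> Y (k + card F)"
    using reach F_sub sub(4) finite_subset[OF F_sub finite_A]
    unfolding X'_def by (intro states_insert_set) (auto simp: reachable_def)
  then have "(X', U(i := W \<union> (X i \<union> F))) \<in> states \<tau> \<theta> Y (k + card F + 1)"
    using transition_in_states[of "(X', U)" \<tau> \<theta> Y "k + card F" "Prune i"]
    by (simp add: in_letters W_def X'_def)
  moreover have "X' \<le> A" using sub(1) F_sub by (auto simp: X'_def le_fun_def)
  moreover have "A \<le> U(i := W \<union> (X i \<union> F))"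
  proof -
    have "sumset X \<subseteq> sumset X'" by (intro sumset_mono) (auto simp: X'_def le_fun_def)
    then have "missed_degree (sumset X') (U (\<not> i)) a \<le> missed_degree (sumset X) (U (\<not> i)) a" for a
      using reachable_finite_container[OF reach] by (intro missed_degree_mono) auto
    then have "a \<in> W \<union> (X i \<union> F)" if "a \<in> A i" for a
      using high[OF that] sub(2)[of i] that
      by (force simp: W_def low_degree_def not_less intro: order_trans[OF of_nat_mono])
    then show ?thesis using sub(2) by (auto simp: le_fun_def)
  qed
  moreover have "W \<union> (X i \<union> F) \<subseteq> Y" using sub F_sub by (fastforce simp: W_def low_degree_def)
  then have "U(i := W \<union> (X i \<union> F)) \<le> (\<lambda>_. Y)" using sub(3) by (auto simp: le_fun_def)
  ultimately show ?thesis by (simp add: reachable_def)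
qed

text \<open>
  If few elements of a summand have high degree, they can all be read, and every other element of
  high degree can be discarded.
\<close>

lemma container_within_if_few_high_degree:
  assumes reach: "reachable k X U" and sat: "saturated X U" and F_sub: "F \<subseteq> A i"
    and high: "\<And>a. a \<in> A i \<Longrightarrow> \<theta> * card (U (\<not> i)) < missed_degree (sumset X) (U (\<not> i)) a
      \<Longrightarrow> a \<in> X i \<union> F"
    and small: "card F + \<tau> < \<theta> * card (A i)"
  shows "container_within (k + card F + 1)"
proof -
  define X' where "X' = X(i := X i \<union> F)"
  define V where "V = U (\<not> i)"
  define W where "W = low_degree (\<theta> * card V) (sumset X') V (U i)"
  define U' where "U' = U(i := W \<union> (X i \<union> F))"
  have reach': "reachable (k + card F + 1) X' U'"
    using reachable_prune[OF reach F_sub high] by (simp add: X'_def V_def W_def U'_def)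
  have fin: "finite (X i)" "finite F" "finite V" "finite W"
    using reachable_finite_fingerprint[OF reach] reachable_finite_container[OF reach]
      finite_subset[OF F_sub finite_A]
    by (auto simp: V_def W_def low_degree_def)
  have "A i \<subseteq> W \<union> (X i \<union> F)" "A (\<not> i) \<subseteq> V" "U' \<le> (\<lambda>_. Y)"
    using reach reach' le_funD[of A U' i] le_funD[of A U "\<not> i"]
    by (auto simp: reachable_def U'_def V_def)
  have "sumset X \<subseteq> sumset X'"
    by (intro sumset_mono) (auto simp: X'_def le_fun_def)
  then have "missed_degree (sumset X') (X i) b \<le> missed_degree (sumset X) (X i) b" for b
    by (intro missed_degree_mono fin) simp
  then have low: "missed_degree (sumset X') (X i) b \<le> \<tau>" if "b \<in> V" for b
    using saturatedD[OF sat that[unfolded V_def]] by (meson of_nat_mono order_trans)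
  have "V \<noteq> {}"
    using \<open>A (\<not> i) \<subseteq> V\<close> s_le_card[of "\<not> i"] s_pos by auto
  moreover have "\<theta> * card (A i) \<le> \<theta> * card (W \<union> (X i \<union> F))"
    using \<open>A i \<subseteq> _\<close> fin \<theta>_pos by (intro mult_left_mono) (auto intro: card_mono)
  then have "card F + \<tau> < \<theta> * card (W \<union> (X i \<union> F))" using small by linarith
  ultimately have "missed_pairs (sumset X') (W \<union> (X i \<union> F)) V
      < 2 * \<theta> * card (W \<union> (X i \<union> F)) * card V"
    using fin low \<theta>_pos by (intro few_missed_pairs_if_low_degree) (auto simp: W_def low_degree_def)
  then have "sparse \<mu> (2 * \<theta>) (container Y (X', U'))"
    using sparse_container_iff[OF \<open>U' \<le> _\<close>, of \<mu> "2 * \<theta>" X'] missed_pairs_sides[of _ U' i]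
    by (cases i) (simp_all add: U'_def V_def mult_ac)
  then show ?thesis using reach' unfolding container_within_def by blast
qed

lemma potential_decreases:
  assumes reach: "reachable k X U" and reach': "reachable k' X' U'" and sat': "saturated X' U'"
    and sub: "X \<le> X'" "U' \<le> U" and F_props: "F \<subseteq> X' i" "card F = s"
    and high: "\<And>a. a \<in> F \<Longrightarrow> \<theta> * card (U (\<not> i)) \<le> missed_degree (sumset X) (U (\<not> i)) a"
  shows "potential X' U' \<le> potential X U - \<theta> / 2 * card (U (\<not> i))"
proof -
  have fin: "finite (X j)" "finite (X' j)" "finite (U j)" for j
    using reachable_finite_fingerprint[OF reach] reachable_finite_fingerprint[OF reach']
      reachable_finite_container[OF reach] by simp_all
  have "missed_degree (sumset X') F b \<le> \<tau>" if "b \<in> U' (\<not> i)" for b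
  proof -
    have "missed_degree (sumset X') F b \<le> missed_degree (sumset X') (X' i) b"
      by (intro missed_degree_mono fin F_props) simp
    also have "\<dots> \<le> \<tau>"
      using sat' that by (rule saturatedD)
    finally show ?thesis by simp
  qed
  then have "(\<theta> * card F - \<tau>) * card (U (\<not> i)) \<le> card F *
      (real (card (sumset X')) - card (sumset X) + (real (card (U (\<not> i))) - card (U' (\<not> i))))"
    using sub fin finite_subset[OF F_props(1) fin(2)] high \<tau>_pos
    by (intro high_degree_progress finite_sumset sumset_mono) (auto simp: le_fun_def)
  moreover have "(\<theta> * card F - \<tau>) * card (U (\<not> i)) = card F * (\<theta> / 2 * card (U (\<not> i)))"
    by (simp add: F_props(2) \<tau>_def field_simps)
  ultimately have "\<theta> / 2 * card (U (\<not> i))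
      \<le> real (card (sumset X')) - card (sumset X) + (real (card (U (\<not> i))) - card (U' (\<not> i)))"
    using F_props(2) s_pos by (simp only: mult_le_cancel_left_pos of_nat_0_less_iff)
  moreover have "card (U' i) \<le> card (U i)"
    using sub(2) fin by (intro card_mono) (auto simp: le_fun_def)
  ultimately show ?thesis by (simp add: potential_def total_card_eq[of _ i])
qed

lemma saturation_round:
  assumes reach: "reachable k X U" and sat: "saturated X U"
    and big: "\<mu> < card (U (\<not> i))" and large: "s + \<tau> \<le> \<theta> * card (A i)"
  obtains (finished) "container_within (k + s + 1)"
  | (continued) k' X' U' where "reachable k' X' U'" "saturated X' U'"
    "real k' \<le> k + s + 1 + (real (card (sumset X')) - card (sumset X)) / \<tau>"
    "potential X' U' \<le> potential X U - \<theta> * \<mu> / 2"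
proof -
  define H where "H = {a \<in> A i. \<theta> * card (U (\<not> i)) < missed_degree (sumset X) (U (\<not> i)) a}"
  show thesis
  proof (cases "card H < s")
    case True
    then have "container_within (k + card H + 1)"
      using large by (intro container_within_if_few_high_degree[OF reach sat]) (auto simp: H_def)
    then have "container_within (k + s + 1)"
      by (rule container_within_mono) (use True in simp)
    then show thesis by (rule finished)
  next
    case False
    then have "s \<le> card H" by simp
    then obtain F where F_props: "F \<subseteq> H" "card F = s" by (metis obtain_subset_with_card_n)
    then have "one_side i F \<le> A" by (auto simp: H_def le_fun_def)
    then obtain k' X' U' where new: "reachable k' X' U'" "saturated X' U'"
        "sup X (one_side i F) \<le> X'" "U' \<le> U"
      and cost: "real k' \<le> k + total_card (one_side i F) + 1
        + (real (card (sumset X')) - card (sumset X)) / \<tau>"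
      by (rule reachable_saturated[OF reach])
    have "X \<le> X'" using new(3) by simp
    moreover have "F \<subseteq> X' i" using le_funD[OF new(3), of i] by simp
    ultimately have "potential X' U' \<le> potential X U - \<theta> / 2 * card (U (\<not> i))"
      using new F_props by (intro potential_decreases[OF reach, where F = F]) (auto simp: H_def)
    moreover have "\<theta> * \<mu> / 2 \<le> \<theta> / 2 * card (U (\<not> i))" using big \<theta>_pos by simp
    ultimately show thesis
      using cost F_props(2) by (intro continued[OF new(1,2)]) (simp_all add: total_card_one_side)
  qed
qed

lemma container_within_if_small_containers:
  assumes "reachable k X U" "\<And>i. card (U i) \<le> \<mu>"
  shows "container_within k"
proof -
  have "sparse \<mu> (2 * \<theta>) (container Y (X, U))"
    using assms by (simp add: sparse_container_iff reachable_def)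
  then show ?thesis using assms(1) unfolding container_within_def by blast
qed

lemma container_by_rounds:
  assumes "reachable k X U" "saturated X U"
    and large: "\<And>i. s + \<tau> \<le> \<theta> * card (A i)"
    and "potential X U + card (sumset A) \<le> r * (\<theta> * \<mu> / 2)"
  shows "\<exists>l. container_within l \<and>
    l \<le> k + (real (card (sumset A)) - card (sumset X)) / \<tau> + (real r + 1) * (s + 1)"
  using assms(1,2,4)
proof (induction r arbitrary: k X U)
  case 0
  then have "total_card U = 0"
    using reachable_card_sumset_le[OF 0(1)] by (simp add: potential_def)
  then have "card (U i) \<le> \<mu>" for i using \<mu>_pos by (cases i) (auto simp: total_card_def)
  with 0(1) have "container_within k" by (rule container_within_if_small_containers)
  then show ?case using reachable_slack_nonneg[OF 0(1)] by (intro exI[of _ k]) simp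
next
  case (Suc r)
  note nonneg = reachable_slack_nonneg[OF Suc.prems(1)]
  show ?case
  proof (cases "\<forall>i. card (U i) \<le> \<mu>")
    case True
    with Suc.prems(1) have "container_within k"
      by (intro container_within_if_small_containers) auto
    then show ?thesis using nonneg by (intro exI[of _ k]) simp
  next
    case False
    then obtain j where "\<mu> < card (U j)" by (auto simp: not_le)
    then have "\<mu> < card (U (\<not> \<not> j))" by simp
    from Suc.prems(1,2) this large show ?thesis
    proof (cases rule: saturation_round)
      case finished
      then show ?thesis using nonneg by (intro exI[of _ "k + s + 1"]) (simp add: algebra_simps)
    next
      case (continued k' X' U')
      have "potential X' U' + card (sumset A) \<le> r * (\<theta> * \<mu> / 2)"
        using continued(4) Suc.prems(3) by (simp add: algebra_simps)
      from Suc.IH[OF continued(1,2) this] obtain l where "container_within l"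
        and "l \<le> k' + (real (card (sumset A)) - card (sumset X')) / \<tau> + (real r + 1) * (s + 1)"
        by blast
      then show ?thesis
        using continued(3) by (intro exI[of _ l]) (simp add: diff_divide_distrib algebra_simps)
    qed
  qed
qed

lemma container_if_small_summand:
  assumes small: "\<theta> * card (A i) < s + \<tau>"
  shows "\<exists>k. container_within k \<and>
    k \<le> card (sumset A) / \<tau> + (1 / \<theta> + 4) * (s + 1)"
proof -
  have "one_side i (A i) \<le> A" by (simp add: le_fun_def)
  then obtain k X U where new: "reachable k X U" "saturated X U"
      "sup (\<lambda>_. {}) (one_side i (A i)) \<le> X"
    and cost: "real k \<le> (0::nat) + total_card (one_side i (A i)) + 1
      + (real (card (sumset X)) - card (sumset (\<lambda>_. {} :: 'a set))) / \<tau>"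
    by (rule reachable_saturated[OF reachable_start])
  have "\<theta> * s \<le> \<theta> * card (A i)" using s_le_card \<theta>_pos by simp
  moreover have "\<tau> < \<theta> * s" using \<theta>_pos s_pos by (simp add: \<tau>_def)
  ultimately have "container_within (k + card ({} :: 'a set) + 1)"
    using le_funD[OF new(3), of i]
    by (intro container_within_if_few_high_degree[OF new(1,2)]) auto
  moreover have "\<theta> * card (A i) \<le> s + \<theta> * s" using small \<open>\<tau> < \<theta> * s\<close> by linarith
  then have "card (A i) \<le> (1 / \<theta> + 1) * s" using \<theta>_pos by (simp add: field_simps)
  moreover have "real (card (sumset X)) / \<tau> \<le> card (sumset A) / \<tau>"
    using reachable_card_sumset_le[OF new(1)] \<tau>_pos by (simp add: divide_right_mono)
  moreover have "(1 / \<theta> + 1) * s + 2 \<le> (1 / \<theta> + 4) * (s + 1)"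
    using \<theta>_pos by (simp add: algebra_simps)
  ultimately show ?thesis
    using cost by (intro exI[of _ "k + 1"]) (simp add: total_card_one_side sumset_def)
qed

lemma card_container_le:
  assumes reach: "reachable k X U" and sat: "saturated X U" and "s \<le> card (X (\<not> i))"
  shows "card (U i) \<le> 2 * card (sumset X)"
proof -
  define T where "T = X (\<not> i)"
  have fin: "finite (X j)" "finite (U j)" for j
    using reachable_finite_fingerprint[OF reach] reachable_finite_container[OF reach] by simp_all
  have "\<tau> \<le> real s / 2" using mult_right_mono[OF \<theta>_le_1, of s] by (simp add: \<tau>_def)
  then have "real (card T) / 2 * card (U i) \<le> (card T - \<tau>) * card (U i)"
    using assms(3) by (intro mult_right_mono) (auto simp: T_def)
  also have "\<dots> \<le> real (card T * card (sumset X))"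
    using sat fin unfolding T_def
    by (intro card_mult_card_le_if_missed_degree_le finite_sumset) (auto simp: saturated_def)
  finally have "card T * real (card (U i)) \<le> card T * (2 * real (card (sumset X)))" by simp
  moreover have "0 < card T" using assms(3) s_pos by (simp add: T_def)
  ultimately show ?thesis by simp
qed

lemma container_if_large_summands:
  assumes large: "\<And>i. s + \<tau> \<le> \<theta> * card (A i)"
  shows "\<exists>k. container_within k \<and>
    k \<le> card (sumset A) / \<tau> + (8 * real (card (sumset A)) / (\<theta> * \<mu>) + 4) * (s + 1)"
proof -
  define q where "q = 8 * real (card (sumset A)) / (\<theta> * \<mu>)"
  have "\<forall>i. \<exists>F. F \<subseteq> A i \<and> card F = s" using s_le_card by (metis obtain_subset_with_card_n)
  then obtain F where F_props: "\<And>i. F i \<subseteq> A i" "\<And>i. card (F i) = s" by metis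
  have "F \<le> A" using F_props by (simp add: le_fun_def)
  then obtain k X U where new: "reachable k X U" "saturated X U" "sup (\<lambda>_. {}) F \<le> X"
    and cost: "real k \<le> (0::nat) + total_card F + 1
      + (real (card (sumset X)) - card (sumset (\<lambda>_. {} :: 'a set))) / \<tau>"
    by (rule reachable_saturated[OF reachable_start])
  have "s \<le> card (X i)" for i
    using card_mono[OF reachable_finite_fingerprint[OF new(1)], of "F i" i]
      le_funD[OF new(3), of i] F_props(2)[of i] by simp
  then have "card (U i) \<le> 2 * card (sumset X)" for i
    using new(1,2) by (intro card_container_le)
  from add_mono[OF this[of False] this[of True]] have "total_card U \<le> 4 * card (sumset X)"
    by (simp add: total_card_def)
  then have "potential X U + card (sumset A) \<le> 4 * card (sumset A)"
    using reachable_card_sumset_le[OF new(1)] by (simp add: potential_def)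
  also have "\<dots> = q * (\<theta> * \<mu> / 2)" using \<theta>_pos \<mu>_pos by (simp add: q_def)
  also have "\<dots> \<le> nat \<lceil>q\<rceil> * (\<theta> * \<mu> / 2)"
    using \<theta>_pos \<mu>_pos by (intro mult_right_mono of_nat_ceiling) auto
  finally obtain l where "container_within l"
    and l_le: "l \<le> k + (real (card (sumset A)) - card (sumset X)) / \<tau>
      + (real (nat \<lceil>q\<rceil>) + 1) * (s + 1)"
    using container_by_rounds[OF new(1,2) large] by blast
  have "0 \<le> q" using \<theta>_pos \<mu>_pos by (simp add: q_def)
  then have "real (nat \<lceil>q\<rceil>) + 1 \<le> q + 2" by linarith
  then have "(real (nat \<lceil>q\<rceil>) + 1) * (s + 1) \<le> (q + 2) * (s + 1)"
    by (intro mult_right_mono) auto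
  moreover have "k \<le> 2 * (real s + 1) + card (sumset X) / \<tau>"
    using cost F_props(2) by (simp add: total_card_def sumset_def)
  ultimately have "l \<le> card (sumset A) / \<tau> + (q + 4) * (s + 1)"
    using l_le by (simp add: diff_divide_distrib algebra_simps)
  then show ?thesis using \<open>container_within l\<close> unfolding q_def by blast
qed

theorem container_exists:
  "\<exists>k. container_within k \<and> k \<le> 2 * real (card (sumset A)) / (\<theta> * s)
    + ((8 * real (card (sumset A)) / \<mu> + 1) / \<theta> + 4) * (s + 1)"
proof -
  define N where "N = real (card (sumset A))"
  define c where "c = (8 * N / \<mu> + 1) / \<theta>"
  have "c = 8 * N / (\<theta> * \<mu>) + 1 / \<theta>"
    by (simp add: c_def add_divide_distrib mult.commute)
  moreover have "0 \<le> 8 * N / (\<theta> * \<mu>)" "0 \<le> 1 / \<theta>"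
    using \<theta>_pos \<mu>_pos by (simp_all add: N_def)
  ultimately have dominated: "1 / \<theta> + 4 \<le> c + 4" "8 * N / (\<theta> * \<mu>) + 4 \<le> c + 4" by linarith+
  have "\<exists>k. container_within k \<and> k \<le> N / \<tau> + (c + 4) * (s + 1)"
  proof (cases "\<forall>i. s + \<tau> \<le> \<theta> * card (A i)")
    case True
    then obtain k where "container_within k" "k \<le> N / \<tau> + (8 * N / (\<theta> * \<mu>) + 4) * (s + 1)"
      using container_if_large_summands unfolding N_def by blast
    with mult_right_mono[OF dominated(2), of "real (s + 1)"]
    have "k \<le> N / \<tau> + (c + 4) * (s + 1)" by linarith
    then show ?thesis using \<open>container_within k\<close> by blast
  next
    case False
    then obtain i where "\<theta> * card (A i) < s + \<tau>" by (auto simp: not_le)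
    then obtain k where "container_within k" "k \<le> N / \<tau> + (1 / \<theta> + 4) * (s + 1)"
      using container_if_small_summand[of i] unfolding N_def by blast
    with mult_right_mono[OF dominated(1), of "real (s + 1)"]
    have "k \<le> N / \<tau> + (c + 4) * (s + 1)" by linarith
    then show ?thesis using \<open>container_within k\<close> by blast
  qed
  moreover have "N / \<tau> = 2 * N / (\<theta> * s)" by (simp add: \<tau>_def)
  ultimately show ?thesis unfolding N_def c_def by (simp only:)
qed

end

section \<open>The container theorem\<close>

definition small_sumset_pair :: "real \<Rightarrow> nat \<Rightarrow> 'a::ab_group_add set \<Rightarrow> 'a set \<Rightarrow> 'a set \<Rightarrow> bool" where
  "small_sumset_pair \<epsilon> m Y A B \<longleftrightarrow> A \<subseteq> Y \<and> B \<subseteq> Y \<and> real (card A) \<ge> sqrt (real m) \<and>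
    real (card B) \<ge> (1 + 1 / \<epsilon>\<^sup>2) * sqrt (real m) \<and> card (A + B) \<le> m"

definition batch_size :: "nat \<Rightarrow> nat" where
  "batch_size m = nat \<lceil>sqrt m / 4\<rceil>"

text \<open>
  Words of this length give the exponent \<open>2 ^ 7\<close>, since there are \<open>2 n + 4 \<le> n\<^sup>2\<close> letters.
\<close>

definition word_length :: "real \<Rightarrow> nat \<Rightarrow> nat" where
  "word_length \<epsilon> m = nat \<lfloor>64 * (1 / \<epsilon>\<^sup>2) * sqrt m\<rfloor>"

definition candidates :: "real \<Rightarrow> nat \<Rightarrow> 'a::ab_group_add set \<Rightarrow> ('a set \<times> 'a set \<times> 'a set) set" where
  "candidates \<epsilon> m Y = container Y `
    states (\<epsilon>\<^sup>2 / 2 * batch_size m / 2) (\<epsilon>\<^sup>2 / 2) Y (word_length \<epsilon> m)"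

definition containers :: "real \<Rightarrow> nat \<Rightarrow> 'a::ab_group_add set \<Rightarrow> ('a set \<times> 'a set \<times> 'a set) set" where
  "containers \<epsilon> m Y = {c \<in> candidates \<epsilon> m Y \<inter> Pow (Y + Y) \<times> Pow Y \<times> Pow Y.
    sparse (m / 4) (\<epsilon>\<^sup>2) c \<and> (\<exists>A B. small_sumset_pair \<epsilon> m Y A B)}"

lemma inverse_square_ge_16:
  fixes \<epsilon> :: real
  assumes "0 < \<epsilon>" "\<epsilon> < 1 / 4"
  shows "16 \<le> 1 / \<epsilon>\<^sup>2"
  using power_mono[of \<epsilon> "1 / 4" 2] assms by (simp add: power2_eq_square field_simps)

lemma batch_size_bounds: "sqrt m / 4 \<le> batch_size m" "batch_size m \<le> sqrt m / 4 + 1"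
  unfolding batch_size_def by (auto simp: real_nat_ceiling_ge)

lemma card_le_card_set_plus:
  fixes A B :: "'a::ab_group_add set"
  assumes "finite A" "finite B" "A \<noteq> {}"
  shows "card B \<le> card (A + B)"
proof -
  obtain a where "a \<in> A" using assms by auto
  then show ?thesis
    using assms by (intro card_inj_on_le[of "(+) a"] finite_set_plus) (auto intro: set_plus_intro)
qed

lemma small_sumset_pair_bounds:
  assumes pair: "small_sumset_pair \<epsilon> m Y A B" and "finite Y" "0 < m" and eps: "0 < \<epsilon>" "\<epsilon> < 1 / 4"
  shows "17 \<le> sqrt m" "4 \<le> card Y" "3 / \<epsilon> \<le> card B"
proof -
  have sqrt_ge: "1 \<le> sqrt m" using \<open>0 < m\<close> by simp
  have E_ge: "16 \<le> 1 / \<epsilon>\<^sup>2" using eps by (rule inverse_square_ge_16)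
  have pair_cards: "sqrt m \<le> card A" "(1 + 1 / \<epsilon>\<^sup>2) * sqrt m \<le> card B" "card (A + B) \<le> m"
    and fin: "finite A" "finite B" and "B \<subseteq> Y"
    using pair \<open>finite Y\<close> by (auto simp: small_sumset_pair_def intro: finite_subset)
  have "17 * sqrt m \<le> (1 + 1 / \<epsilon>\<^sup>2) * sqrt m" using E_ge sqrt_ge by (intro mult_right_mono) auto
  then have card_B: "17 * sqrt m \<le> card B" using pair_cards(2) by linarith
  have "A \<noteq> {}" using pair_cards(1) sqrt_ge by auto
  then have "real (card B) \<le> real m" using card_le_card_set_plus[OF fin] pair_cards(3) by simp
  then have "17 * sqrt m \<le> sqrt m * sqrt m" using card_B by simp
  then show "17 \<le> sqrt m" by (rule mult_right_le_imp_le) (use sqrt_ge in linarith)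
  show "4 \<le> card Y" using card_B sqrt_ge card_mono[OF \<open>finite Y\<close> \<open>B \<subseteq> Y\<close>] by linarith
  have "3 / \<epsilon> \<le> 1 / \<epsilon>\<^sup>2" using eps by (simp add: field_simps power2_eq_square)
  also have "\<dots> \<le> (1 + 1 / \<epsilon>\<^sup>2) * 1" by simp
  also have "\<dots> \<le> (1 + 1 / \<epsilon>\<^sup>2) * sqrt m" using sqrt_ge by (intro mult_left_mono) auto
  finally show "3 / \<epsilon> \<le> card B" using pair_cards(2) by linarith
qed

lemma word_length_suffices:
  fixes \<epsilon> N :: real
  assumes eps: "0 < \<epsilon>" "\<epsilon> < 1 / 4" and sqrt_ge: "17 \<le> sqrt m" and "0 \<le> N" "N \<le> m"
  shows "2 * N / (\<epsilon>\<^sup>2 / 2 * batch_size m)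
      + ((8 * N / (m / 4) + 1) / (\<epsilon>\<^sup>2 / 2) + 4) * (batch_size m + 1)
    \<le> 64 * (1 / \<epsilon>\<^sup>2) * sqrt m"
proof -
  define E s where "E = 1 / \<epsilon>\<^sup>2" and "s = real (batch_size m)"
  have E_ge: "16 \<le> E" unfolding E_def using eps by (rule inverse_square_ge_16)
  have s_bounds: "sqrt m / 4 \<le> s" "s + 1 \<le> sqrt m / 2" "0 < s"
    using batch_size_bounds[of m] sqrt_ge unfolding s_def by linarith+
  have "0 < m" using sqrt_ge by (auto intro: Nat.gr0I)
  have "N / s \<le> m / (sqrt m / 4)" using assms s_bounds \<open>0 < m\<close> by (intro frac_le) auto
  also have "\<dots> = 4 * (m / sqrt m)" by simp
  also have "m / sqrt m = sqrt m" by (simp add: real_div_sqrt)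
  finally have "4 * E * (N / s) \<le> 4 * E * (4 * sqrt m)" using E_ge by (intro mult_left_mono) auto
  then have saturation_cost: "2 * N / (\<epsilon>\<^sup>2 / 2 * s) \<le> 16 * (E * sqrt m)"
    by (simp add: E_def)
  have "8 * N / (m / 4) + 1 \<le> 33" using \<open>0 < m\<close> \<open>N \<le> m\<close> by (simp add: field_simps)
  then have "(8 * N / (m / 4) + 1) * (2 * E) \<le> 33 * (2 * E)"
    using E_ge by (intro mult_right_mono) auto
  then have "(8 * N / (m / 4) + 1) / (\<epsilon>\<^sup>2 / 2) + 4 \<le> 67 * E" using E_ge by (simp add: E_def)
  then have rounds_cost:
    "((8 * N / (m / 4) + 1) / (\<epsilon>\<^sup>2 / 2) + 4) * (s + 1) \<le> 67 * E * (sqrt m / 2)"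
    using E_ge s_bounds by (intro mult_mono) auto
  have "0 \<le> E * sqrt m" using E_ge sqrt_ge by simp
  then show ?thesis
    using saturation_cost rounds_cost
    by (simp only: s_def[symmetric] E_def[symmetric] of_nat_add of_nat_1)
qed

lemma card_candidates_le:
  assumes "finite Y" "4 \<le> card Y"
  shows "card (candidates \<epsilon> m Y) \<le> real (card Y) powr (2 ^ 7 * (1 / \<epsilon>\<^sup>2) * sqrt m)"
proof -
  define n L where "n = card Y" and "L = word_length \<epsilon> m"
  have "4 \<le> n" using assms(2) by (simp add: n_def)
  with mult_le_mono1[OF this, of n] have "2 * n + 4 \<le> n ^ 2"
    unfolding power2_eq_square by linarith
  then have "(2 * n + 4) ^ L \<le> (n ^ 2) ^ L" by (rule power_mono) simp
  moreover have "card (candidates \<epsilon> m Y) \<le> (2 * n + 4) ^ L"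
    unfolding candidates_def n_def L_def
    using assms(1) by (intro order_trans[OF card_image_le card_states_le] finite_states)
  ultimately have "real (card (candidates \<epsilon> m Y)) \<le> real ((n ^ 2) ^ L)" by linarith
  also have "\<dots> = real n ^ (2 * L)" by (simp flip: power_mult)
  also have "\<dots> = real n powr real (2 * L)"
    by (rule powr_realpow[symmetric]) (use \<open>4 \<le> n\<close> in simp)
  also have "\<dots> \<le> real n powr (2 ^ 7 * (1 / \<epsilon>\<^sup>2) * sqrt m)"
  proof (rule powr_mono)
    have "L \<le> 64 * (1 / \<epsilon>\<^sup>2) * sqrt m" by (simp add: L_def word_length_def)
    then show "real (2 * L) \<le> 2 ^ 7 * (1 / \<epsilon>\<^sup>2) * sqrt m" by simp
  qed (use \<open>4 \<le> n\<close> in simp)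
  finally show ?thesis by (simp add: n_def)
qed

lemma card_add_card_le_if_sparse:
  fixes D :: "'a::ab_group_add set" and \<epsilon> m :: real
  assumes eps: "0 < \<epsilon>" "\<epsilon> < 1 / 4" and "finite Y" "C1 \<subseteq> Y" "C2 \<subseteq> Y" "finite D" "card D \<le> m"
    and "3 / \<epsilon> \<le> real (card C1) + real (card C2)"
    and sparse: "sparse (m / 4) (\<epsilon>\<^sup>2) ((Y + Y) - D, C1, C2)"
  shows "real (card C1) + real (card C2) \<le> (1 + 2 * \<epsilon>) * (m + beta TYPE('a) ((1 + 4 * \<epsilon>) * m))"
proof -
  consider (small) "card C1 \<le> m / 4" "card C2 \<le> m / 4"
    | (few) "missed_pairs D C1 C2 < \<epsilon>\<^sup>2 * card C1 * card C2"
    using sparse card_sum_hyperedges[OF \<open>C1 \<subseteq> Y\<close> \<open>C2 \<subseteq> Y\<close>] by (auto simp: sparse_def)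
  then show ?thesis
  proof cases
    case small
    then have "real (card C1) + real (card C2) \<le> m" using assms by linarith
    also have "\<dots> \<le> (1 + 2 * \<epsilon>) * m" using assms by (simp add: algebra_simps)
    also have "\<dots> \<le> (1 + 2 * \<epsilon>) * (m + beta TYPE('a) ((1 + 4 * \<epsilon>) * m))"
      using eps by (intro mult_left_mono) auto
    finally show ?thesis .
  next
    case few
    then show ?thesis
      using assms finite_subset by (intro card_add_card_le_if_few_missed_pairs[of \<epsilon> C1 C2 D m]) auto
  qed
qed

lemma card_containers_le:
  assumes "finite Y" "0 < m" "0 < \<epsilon>" "\<epsilon> < 1 / 4"
  shows "card (containers \<epsilon> m Y) \<le> real (card Y) powr (2 ^ 7 * (1 / \<epsilon>\<^sup>2) * sqrt m)"
proof (cases "\<exists>A B. small_sumset_pair \<epsilon> m Y A B")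
  case True
  then have "4 \<le> card Y" using small_sumset_pair_bounds(2) assms by blast
  moreover have "card (containers \<epsilon> m Y) \<le> card (candidates \<epsilon> m Y)"
    using assms(1) by (intro card_mono) (auto simp: containers_def candidates_def finite_states)
  ultimately show ?thesis
    using card_candidates_le[OF assms(1), of \<epsilon> m] by linarith
qed (simp add: containers_def)

lemma summand_pair_if_small_sumset_pair:
  assumes pair: "small_sumset_pair \<epsilon> m Y A B" and "finite Y" "0 < m" and eps: "0 < \<epsilon>" "\<epsilon> < 1 / 4"
  shows "summand_pair Y (\<lambda>i. if i then B else A) (batch_size m) (\<epsilon>\<^sup>2 / 2) (m / 4)"
proof -
  have pair_props: "A \<subseteq> Y" "B \<subseteq> Y" "sqrt m \<le> card A" "(1 + 1 / \<epsilon>\<^sup>2) * sqrt m \<le> card B"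
    using pair by (auto simp: small_sumset_pair_def)
  have "17 \<le> sqrt m" using assms by (rule small_sumset_pair_bounds)
  moreover have "sqrt m \<le> (1 + 1 / \<epsilon>\<^sup>2) * sqrt m" by (simp add: algebra_simps)
  ultimately have "0 < batch_size m" "batch_size m \<le> card A" "batch_size m \<le> card B"
    using batch_size_bounds[of m] pair_props(3,4) by linarith+
  then show ?thesis
    using \<open>finite Y\<close> \<open>0 < m\<close> eps pair_props power_le_one[of \<epsilon> 2]
    by unfold_locales (auto simp: le_fun_def)
qed

lemma container_exists_if_small_sumset_pair:
  fixes Y :: "'a::ab_group_add set" and \<epsilon> :: real
  assumes pair: "small_sumset_pair \<epsilon> m Y A B" and "finite Y" "0 < m" and eps: "0 < \<epsilon>" "\<epsilon> < 1 / 4"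
  shows "\<exists>(C0, C1, C2) \<in> containers \<epsilon> m Y. (Y + Y) - (A + B) \<subseteq> C0 \<and> A \<subseteq> C1 \<and> B \<subseteq> C2 \<and>
    real (card C1) + real (card C2) \<le> (1 + 2 * \<epsilon>) * (real m + beta TYPE('a) ((1 + 4 * \<epsilon>) * m))"
proof -
  define S where "S i = (if i then B else A)" for i
  have S_simps: "S False = A" "S True = B" "sumset S = A + B" by (simp_all add: S_def sumset_def)
  interpret summand_pair Y S "batch_size m" "\<epsilon>\<^sup>2 / 2" "real m / 4"
    unfolding S_def using assms by (rule summand_pair_if_small_sumset_pair)
  note bounds = small_sumset_pair_bounds[OF assms]
  have "card (sumset S) \<le> m" using pair by (simp add: S_simps small_sumset_pair_def)
  then have "2 * real (card (sumset S)) / (\<epsilon>\<^sup>2 / 2 * batch_size m)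
      + ((8 * real (card (sumset S)) / (m / 4) + 1) / (\<epsilon>\<^sup>2 / 2) + 4) * (batch_size m + 1)
    \<le> 64 * (1 / \<epsilon>\<^sup>2) * sqrt m"
    by (intro word_length_suffices eps bounds(1)) simp_all
  then have "container_within (word_length \<epsilon> m)"
    using container_exists container_within_mono le_nat_floor order_trans
    unfolding word_length_def by meson
  then obtain X U where reach: "reachable (word_length \<epsilon> m) X U"
    and sparse: "sparse (m / 4) (\<epsilon>\<^sup>2) ((Y + Y) - sumset X, U False, U True)"
    by (auto simp: container_within_def container_def)
  then have "(X, U) \<in> states \<tau> (\<epsilon>\<^sup>2 / 2) Y (word_length \<epsilon> m)"
    and "sumset X \<subseteq> A + B" "\<And>i. S i \<subseteq> U i" "\<And>i. U i \<subseteq> Y"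
    using sumset_mono[of X S] by (auto simp: reachable_def S_simps le_fun_def)
  then have cand: "((Y + Y) - sumset X, U False, U True) \<in> candidates \<epsilon> m Y"
    and sub: "sumset X \<subseteq> A + B" "A \<subseteq> U False" "B \<subseteq> U True" "U False \<subseteq> Y" "U True \<subseteq> Y"
    by (force simp: candidates_def container_def \<tau>_def S_simps[symmetric])+
  have "card B \<le> card (U True)" using sub reachable_finite_container[OF reach] by (intro card_mono)
  then have "3 / \<epsilon> \<le> real (card (U False)) + real (card (U True))" using bounds(3) by linarith
  moreover have "finite (sumset X)" "card (sumset X) \<le> real m"
    using finite_sumset[of X] reachable_finite_fingerprint[OF reach]
      reachable_card_sumset_le[OF reach] \<open>card (sumset S) \<le> m\<close>
    by simp_all
  ultimately have "real (card (U False)) + real (card (U True))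
      \<le> (1 + 2 * \<epsilon>) * (real m + beta TYPE('a) ((1 + 4 * \<epsilon>) * m))"
    using sub sparse \<open>finite Y\<close> eps
    by (intro card_add_card_le_if_sparse)
  then show ?thesis
    using cand sub sparse pair
    by (intro bexI[of _ "((Y + Y) - sumset X, U False, U True)"]) (auto simp: containers_def)
qed

theorem theorem1p8:
  fixes n m :: nat and \<epsilon> :: real and Y :: "'a::ab_group_add set" and \<beta> :: nat
  assumes "n > 0" and "m > 0"
    and "0 < \<epsilon>" and "\<epsilon> < 1 / 4"
    and "finite Y" and "card Y = n"
    and "\<beta> = beta TYPE('a) ((1 + 4 * \<epsilon>) * real m)"
  shows "\<exists>\<C> \<subseteq> Pow (Y + Y) \<times> Pow Y \<times> Pow Y.
    real (card \<C>) \<le> real n powr (2 ^ 7 * (1 / \<epsilon>\<^sup>2) * sqrt (real m)) \<and>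
    (\<forall>A B. A \<subseteq> Y \<longrightarrow> B \<subseteq> Y \<longrightarrow>
       real (card A) \<ge> sqrt (real m) \<longrightarrow>
       real (card B) \<ge> (1 + 1 / \<epsilon>\<^sup>2) * sqrt (real m) \<longrightarrow>
       card (A + B) \<le> m \<longrightarrow>
       (\<exists>(C0, C1, C2) \<in> \<C>.
          (Y + Y) - (A + B) \<subseteq> C0 \<and> A \<subseteq> C1 \<and> B \<subseteq> C2 \<and>
          real (card C1) + real (card C2) \<le> (1 + 2 * \<epsilon>) * (real m + real \<beta>))) \<and>
    (\<forall>(C0, C1, C2) \<in> \<C>.
       (real (card C1) \<le> real m / 4 \<and> real (card C2) \<le> real m / 4) \<or>
       real (card (sum_hyperedges C0 C1 C2)) < \<epsilon>\<^sup>2 * real (card C1) * real (card C2))"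
proof -
  have "real (card (containers \<epsilon> m Y)) \<le> real n powr (2 ^ 7 * (1 / \<epsilon>\<^sup>2) * sqrt (real m))"
    using card_containers_le assms by blast
  moreover have "\<exists>(C0, C1, C2) \<in> containers \<epsilon> m Y.
      (Y + Y) - (A + B) \<subseteq> C0 \<and> A \<subseteq> C1 \<and> B \<subseteq> C2 \<and>
      real (card C1) + real (card C2) \<le> (1 + 2 * \<epsilon>) * (real m + real \<beta>)"
    if "small_sumset_pair \<epsilon> m Y A B" for A B
    using container_exists_if_small_sumset_pair[OF that assms(5,2-4)] assms(7) by simp
  moreover have "containers \<epsilon> m Y \<subseteq> Pow (Y + Y) \<times> Pow Y \<times> Pow Y"
    "\<forall>c \<in> containers \<epsilon> m Y. sparse (real m / 4) (\<epsilon>\<^sup>2) c"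
    by (auto simp: containers_def)
  ultimately show ?thesis
    unfolding small_sumset_pair_def sparse_def by (intro exI[of _ "containers \<epsilon> m Y"]) simp
qed

end
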